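(* Let $d\ge 1$, $q\ge 0$, let $\Omega\subseteq\mathbf{R}^d$ be a region and $w\ge 0$ a suitable weight function on $\Omega$. Let $N$ be the number of nodes in a degree $2q+1$, $d$-dimensional, positive weight cubature rule for $\Omega$ and $w$. Then $$N\ge\binom{d+q}{d}+\frac12\max_{i,j}\operatorname{rank}([A_i,A_j]),$$ where $A_1,\dots,A_d$ are the matrix representations of the operators $\chi_1,\dots,\chi_d$ on $\mathcal{P}_q$ and $[A_i,A_j]=A_iA_j-A_jA_i$.
   Context: "Suitable" weight: $\Omega\subseteq\mathbf{R}^d$ and $w:\Omega\to[0,\infty)$ are measurable, $\int_\Omega w(x)|p(x)|\,d^dx<\infty$ for every polynomial $p$, and $\int_\Omega w(x)p(x)^2\,d^dx>0$ for every nonzero polynomial $p$. $\mathcal{P}_m$ is the real vector space of polynomials in $x_1,\dots,x_d$ of total degree at most $m$, with inner product $\langle a|b\rangle=\int_\Omega w(x)a(x)b(x)\,d^dx$. $\Pi_q:\mathcal{P}_{q+1}\to\mathcal{P}_q$ is the orthogonal projection with respect to this inner product, and $\chi_i:\mathcal{P}_q\to\mathcal{P}_q$ is defined by $\chi_ip=\Pi_q(x_ip)$. The matrix representations are taken in an arbitrary orthonormal basis $\{e_a\}$ of $\mathcal{P}_q$ (the same for all $i$): $(A_i)_{ab}=\langle e_a|\chi_ie_b\rangle$. An $N$-point positive weight cubature rule, $\int_\Omega w(x)f(x)\,d^dx\approx\sum_{\alpha=1}^N w_\alpha f(x_\alpha)$, consists of nodes $x_\alpha\in\mathbf{R}^d$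 and weights $w_\alpha>0$. It is of degree $D$ if it is exact (equality holds) for every polynomial $f$ of total degree at most $D$ and non-exact for at least one polynomial of total degree $D+1$. *)

theory Defs
  imports "HOL-Analysis.Analysis" "Jordan_Normal_Form.DL_Rank"
begin

(* Both HOL-Analysis and Jordan_Normal_Form use the symbol $. Here it is the component of a
   vector of type real ^ 'd; the matrices are the Jordan_Normal_Form ones, because their size
   (the dimension of a polynomial space) is a number and not a type. *)
no_notation Matrix.vec_index (infixl \<open>$\<close> 100)

definition monomial_fun :: "('d::finite \<Rightarrow> nat) \<Rightarrow> real ^ 'd \<Rightarrow> real" where
  "monomial_fun k x = (\<Prod>i\<in>UNIV. (x $ i) ^ k i)"

lemma finite_multi_indices: "finite {k :: 'd::finite \<Rightarrow> nat. (\<Sum>i\<in>UNIV. k i) \<le> m}"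
proof (rule finite_subset)
  show "{k :: 'd \<Rightarrow> nat. (\<Sum>i\<in>UNIV. k i) \<le> m} \<subseteq> PiE UNIV (\<lambda>_. {..m})"
  proof
    fix k :: "'d \<Rightarrow> nat"
    assume k: "k \<in> {k. (\<Sum>i\<in>UNIV. k i) \<le> m}"
    have "k i \<le> m" for i
      using k member_le_sum[of i UNIV k] by simp
    then show "k \<in> PiE UNIV (\<lambda>_. {..m})"
      by auto
  qed
  show "finite (PiE (UNIV :: 'd set) (\<lambda>_. {..m}))"
    by (intro finite_PiE) auto
qed

(* Polynomials are identified with the functions they induce, which loses nothing over the
   reals. This is the space P_m of polynomials of total degree at most m. *)
definition polys :: "nat \<Rightarrow> (real ^ 'd::finite \<Rightarrow> real) set" where
  "polys m = {p. \<exists>c. p = (\<lambda>x. \<Sum>k | (\<Sum>i\<in>UNIV. k i) \<le> m. c k * monomial_fun k x)}"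

(* Measurability is with respect to Lebesgue measure; values of w outside \<Omega> are irrelevant. *)
definition suitable_weight :: "(real ^ 'd::finite) set \<Rightarrow> (real ^ 'd \<Rightarrow> real) \<Rightarrow> bool" where
  "suitable_weight \<Omega> w \<longleftrightarrow>
     \<Omega> \<in> sets lebesgue \<and>
     w \<in> borel_measurable (lebesgue_on \<Omega>) \<and>
     (\<forall>x\<in>\<Omega>. 0 \<le> w x) \<and>
     (\<forall>m. \<forall>p\<in>polys m. set_integrable lebesgue \<Omega> (\<lambda>x. w x * \<bar>p x\<bar>)) \<and>
     (\<forall>m. \<forall>p\<in>polys m. p \<noteq> (\<lambda>x. 0) \<longrightarrow> 0 < (LINT x:\<Omega>|lebesgue. w x * (p x)\<^sup>2))"

definition weighted_inner ::
    "(real ^ 'd::finite) set \<Rightarrow> (real ^ 'd \<Rightarrow> real) \<Rightarrow> (real ^ 'd \<Rightarrow> real) \<Rightarrow> (real ^ 'd \<Rightarrow> real) \<Rightarrow> real"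
  where "weighted_inner \<Omega> w a b = (LINT x:\<Omega>|lebesgue. w x * a x * b x)"

(* For a suitable weight the description below determines a unique element for every
   polynomial p. *)
definition orth_proj ::
    "(real ^ 'd::finite) set \<Rightarrow> (real ^ 'd \<Rightarrow> real) \<Rightarrow> nat \<Rightarrow> (real ^ 'd \<Rightarrow> real) \<Rightarrow> (real ^ 'd \<Rightarrow> real)"
  where "orth_proj \<Omega> w q p =
    (THE r. r \<in> polys q \<and> (\<forall>s\<in>polys q. weighted_inner \<Omega> w (\<lambda>x. p x - r x) s = 0))"

definition chi ::
    "(real ^ 'd::finite) set \<Rightarrow> (real ^ 'd \<Rightarrow> real) \<Rightarrow> nat \<Rightarrow> 'd \<Rightarrow> (real ^ 'd \<Rightarrow> real) \<Rightarrow> (real ^ 'd \<Rightarrow> real)"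
  where "chi \<Omega> w q i p = orth_proj \<Omega> w q (\<lambda>x. x $ i * p x)"

(* The basis is e 0, ..., e (n - 1). *)
definition orthonormal_basis ::
    "(real ^ 'd::finite) set \<Rightarrow> (real ^ 'd \<Rightarrow> real) \<Rightarrow> nat \<Rightarrow> nat \<Rightarrow> (nat \<Rightarrow> real ^ 'd \<Rightarrow> real) \<Rightarrow> bool"
  where "orthonormal_basis \<Omega> w q n e \<longleftrightarrow>
     (\<forall>a<n. e a \<in> polys q) \<and>
     (\<forall>a<n. \<forall>b<n. weighted_inner \<Omega> w (e a) (e b) = (if a = b then 1 else 0)) \<and>
     (\<forall>p\<in>polys q. \<exists>c. p = (\<lambda>x. \<Sum>a<n. c a * e a x))"

definition chi_mat ::
    "(real ^ 'd::finite) set \<Rightarrow> (real ^ 'd \<Rightarrow> real) \<Rightarrow> nat \<Rightarrow> nat \<Rightarrow> (nat \<Rightarrow> real ^ 'd \<Rightarrow> real) \<Rightarrow> 'd \<Rightarrow> real Matrix.mat"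
  where "chi_mat \<Omega> w q n e i =
    Matrix.mat n n (\<lambda>(a, b). weighted_inner \<Omega> w (e a) (chi \<Omega> w q i (e b)))"

definition commutator :: "real Matrix.mat \<Rightarrow> real Matrix.mat \<Rightarrow> real Matrix.mat" where
  "commutator A B = A * B - B * A"

(* Nodes xs 1, ..., xs N, which need not lie in \<Omega>, with weights ws 1, ..., ws N. *)
definition positive_cubature_rule ::
    "(real ^ 'd::finite) set \<Rightarrow> (real ^ 'd \<Rightarrow> real) \<Rightarrow> nat \<Rightarrow> nat \<Rightarrow> (nat \<Rightarrow> real ^ 'd) \<Rightarrow> (nat \<Rightarrow> real) \<Rightarrow> bool"
  where "positive_cubature_rule \<Omega> w D N xs ws \<longleftrightarrow>
     (\<forall>\<alpha>\<in>{1..N}. 0 < ws \<alpha>) \<and>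
     (\<forall>f\<in>polys D. (LINT x:\<Omega>|lebesgue. w x * f x) = (\<Sum>\<alpha>=1..N. ws \<alpha> * f (xs \<alpha>))) \<and>
     (\<exists>f\<in>polys (D + 1) - polys D.
        (LINT x:\<Omega>|lebesgue. w x * f x) \<noteq> (\<Sum>\<alpha>=1..N. ws \<alpha> * f (xs \<alpha>)))"

end

theory Submission
  imports Defs
begin

text \<open>Let \<open>E\<close> be the \<open>n \<times> N\<close> matrix with entries \<open>sqrt w\<^sub>\<alpha> * e\<^sub>a(x\<^sub>\<alpha>)\<close> and \<open>X\<^sub>i\<close> the diagonal matrix
  of the \<open>i\<close>-th coordinates of the nodes. Exactness in degree \<open>2q + 1\<close> gives \<open>E E\<^sup>T = 1\<close> and
  \<open>A\<^sub>i = E X\<^sub>i E\<^sup>T\<close>. Since the \<open>X\<^sub>i\<close> commute, \<open>[A\<^sub>i, A\<^sub>j] = E X\<^sub>j Q X\<^sub>i E\<^sup>T - E X\<^sub>i Q X\<^sub>j E\<^sup>T\<close> with the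
  projection \<open>Q = 1 - E\<^sup>T E\<close> of rank \<open>N - n\<close>, so the commutator has rank at most \<open>2(N - n)\<close>.\<close>

section \<open>Linear algebra\<close>

text \<open>Padding the system with zero rows gives a square matrix. Expanding its determinant along
  a zero row shows that it is singular, and a nonzero kernel vector is the required
  solution.\<close>

lemma underdetermined_system:
  fixes A :: "nat \<Rightarrow> nat \<Rightarrow> 'a::field"
  assumes "m < n"
  obtains v where "\<exists>j<n. v j \<noteq> 0" and "\<And>i. i < m \<Longrightarrow> (\<Sum>j<n. A i j * v j) = 0"
proof -
  define B where "B = Matrix.mat n n (\<lambda>(i, j). if i < m then A i j else 0)"
  have B: "B \<in> carrier_mat n n"
    by (simp add: B_def)
  have "Determinant.det B = (\<Sum>j<n. B $$ (m, j) * cofactor B m j)"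
    using assms by (rule laplace_expansion_row[OF B])
  also have "\<dots> = 0"
    using assms by (intro sum.neutral) (simp add: B_def)
  finally obtain v where v: "v \<in> carrier_vec n" "v \<noteq> 0\<^sub>v n" "B *\<^sub>v v = 0\<^sub>v n"
    using det_0_iff_vec_prod_zero_field[OF B] by blast
  have "\<exists>j<n. vec_index v j \<noteq> 0"
    using v(1,2) by (metis carrier_vecD eq_vecI index_zero_vec)
  moreover have "(\<Sum>j<n. A i j * vec_index v j) = 0" if "i < m" for i
  proof -
    have "(\<Sum>j<n. A i j * vec_index v j) = vec_index (B *\<^sub>v v) i"
      using that assms v(1) by (auto simp: B_def scalar_prod_def lessThan_atLeast0 intro!: sum.cong)
    then show ?thesis
      using that assms v(3) by simp
  qed
  ultimately show thesis
    by (rule that)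
qed

section \<open>Orthonormal families of rows in real \<open>N\<close>-space\<close>

definition orthonormal_rows :: "nat \<Rightarrow> nat \<Rightarrow> (nat \<Rightarrow> nat \<Rightarrow> real) \<Rightarrow> bool" where
  "orthonormal_rows n N E \<longleftrightarrow>
     (\<forall>a<n. \<forall>b<n. (\<Sum>\<alpha><N. E a \<alpha> * E b \<alpha>) = (if a = b then 1 else 0))"

text \<open>Orthonormal rows are independent: if their combination with coefficients
  \<open>v\<close> vanishes, its inner product with row \<open>b\<close> gives
  \<open>v b = 0\<close>. More than \<open>N\<close> rows would admit such a combination with
  \<open>v\<close> nonzero.\<close>

lemma orthonormal_rows_le:
  assumes "orthonormal_rows n N E"
  shows "n \<le> N"
proof (rule ccontr)
  assume "\<not> n \<le> N"
  then obtain v where v: "\<exists>a<n. v a \<noteq> 0" "\<And>\<alpha>. \<alpha> < N \<Longrightarrow> (\<Sum>a<n. E a \<alpha> * v a) = 0"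
    using underdetermined_system[of N n "\<lambda>\<alpha> a. E a \<alpha>"] by (metis not_le)
  have "v b = 0" if "b < n" for b
  proof -
    have "v b = (\<Sum>a<n. (if b = a then v a else 0))"
      using that by simp
    also have "\<dots> = (\<Sum>a<n. (\<Sum>\<alpha><N. E b \<alpha> * E a \<alpha>) * v a)"
      using assms that by (intro sum.cong) (simp_all add: orthonormal_rows_def)
    also have "\<dots> = (\<Sum>\<alpha><N. E b \<alpha> * (\<Sum>a<n. E a \<alpha> * v a))"
      by (simp add: sum_distrib_left sum_distrib_right mult.assoc) (rule sum.swap)
    also have "\<dots> = 0"
      using v(2) by simp
    finally show ?thesis .
  qed
  with v(1) show False
    by blast
qed

text \<open>A nonzero vector orthogonal to all rows exists because \<open>n\<close> equations in
  \<open>N > n\<close> unknowns are underdetermined. Dividing it by its length yields the new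
  row.\<close>

lemma orthonormal_rows_extend:
  assumes E: "orthonormal_rows n N E" and "n < N"
  obtains v where "orthonormal_rows (Suc n) N (E(n := v))"
proof -
  obtain u where u: "\<exists>\<alpha><N. u \<alpha> \<noteq> 0" "\<And>a. a < n \<Longrightarrow> (\<Sum>\<alpha><N. E a \<alpha> * u \<alpha>) = 0"
    using underdetermined_system[OF \<open>n < N\<close>, of E] by metis
  define s where "s = (\<Sum>\<alpha><N. u \<alpha> * u \<alpha>)"
  obtain \<gamma> where "\<gamma> < N" "u \<gamma> \<noteq> 0"
    using u(1) by blast
  then have "s > 0"
    unfolding s_def by (intro sum_pos2[of _ \<gamma>]) (auto simp: zero_less_mult_iff)
  define v where "v = (\<lambda>\<alpha>. u \<alpha> / sqrt s)"
  have vv: "(\<Sum>\<alpha><N. v \<alpha> * v \<alpha>) = 1"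
    using \<open>s > 0\<close> by (simp add: v_def s_def flip: sum_divide_distrib)
  have Ev: "(\<Sum>\<alpha><N. E a \<alpha> * v \<alpha>) = 0" if "a < n" for a
    using u(2)[OF that] by (simp add: v_def flip: sum_divide_distrib)
  have vE: "(\<Sum>\<alpha><N. v \<alpha> * E a \<alpha>) = 0" if "a < n" for a
    using Ev[OF that] by (simp add: mult.commute)
  have "orthonormal_rows (Suc n) N (E(n := v))"
    using E vv Ev vE by (auto simp: orthonormal_rows_def less_Suc_eq)
  then show thesis
    by (rule that)
qed

text \<open>For square matrices a right inverse is also a left inverse, so the columns are
  orthonormal too. This makes \<open>1 - E\<^sup>T E\<close> vanish when
  \<open>n = N\<close>.\<close>

lemma orthonormal_rows_square:
  assumes "orthonormal_rows N N E" "\<alpha> < N" "\<beta> < N"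
  shows "(\<Sum>c<N. E c \<alpha> * E c \<beta>) = (if \<alpha> = \<beta> then 1 else 0)"
proof -
  define M where "M = Matrix.mat N N (\<lambda>(a, \<alpha>). E a \<alpha>)"
  have M: "M \<in> carrier_mat N N"
    by (simp add: M_def)
  have "M * M\<^sup>T = 1\<^sub>m N"
    using assms(1)
    by (intro eq_matI) (auto simp: M_def scalar_prod_def orthonormal_rows_def lessThan_atLeast0)
  then have "M\<^sup>T * M = 1\<^sub>m N"
    using M by (intro mat_mult_left_right_inverse[OF M]) auto
  moreover have "(M\<^sup>T * M) $$ (\<alpha>, \<beta>) = (\<Sum>c<N. E c \<alpha> * E c \<beta>)"
    using assms(2,3) by (simp add: M_def scalar_prod_def lessThan_atLeast0)
  ultimately show ?thesis
    using assms(2,3) by simp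
qed

text \<open>\<open>complement_mat\<close> is the matrix \<open>U (1 - E\<^sup>T E) W\<close>.\<close>

definition complement_mat ::
    "nat \<Rightarrow> nat \<Rightarrow> nat \<Rightarrow> (nat \<Rightarrow> nat \<Rightarrow> real) \<Rightarrow> (nat \<Rightarrow> nat \<Rightarrow> real) \<Rightarrow> (nat \<Rightarrow> nat \<Rightarrow> real) \<Rightarrow> real Matrix.mat"
  where "complement_mat m N n E U W = Matrix.mat m m (\<lambda>(a, b).
    \<Sum>\<alpha><N. \<Sum>\<beta><N. U a \<alpha> * ((if \<alpha> = \<beta> then 1 else 0) - (\<Sum>c<n. E c \<alpha> * E c \<beta>)) * W \<beta> b)"

text \<open>Completing the rows of \<open>E\<close> to an orthonormal basis writes \<open>1 - E\<^sup>T E\<close> as a sum of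
  \<open>N - n\<close> matrices of rank one.\<close>

lemma rank_complement_mat_le:
  assumes "orthonormal_rows n N E"
  shows "vec_space.rank m (complement_mat m N n E U W) \<le> N - n"
  using assms
proof (induction "N - n" arbitrary: n E)
  case 0
  then have "n = N"
    using orthonormal_rows_le by fastforce
  then have "complement_mat m N n E U W = 0\<^sub>m m m"
    using orthonormal_rows_square 0 by (intro eq_matI) (auto simp: complement_mat_def)
  then show ?case
    by (simp add: vec_space.rank_0I)
next
  case (Suc k)
  then have "n < N"
    by simp
  obtain v where v: "orthonormal_rows (Suc n) N (E(n := v))"
    using orthonormal_rows_extend[OF Suc.prems \<open>n < N\<close>] .
  let ?C = "complement_mat m N (Suc n) (E(n := v)) U W"
  \<comment> \<open>Adding the row \<open>v\<close> to \<open>E\<close> takes the rank-one matrix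
    with entries \<open>v \<alpha> * v \<beta>\<close> off \<open>1 - E\<^sup>T E\<close>;
    \<open>R\<close> is that matrix multiplied by \<open>U\<close> and \<open>W\<close>.\<close>
  define R where "R = Matrix.mat m m (\<lambda>(a, b). (\<Sum>\<alpha><N. U a \<alpha> * v \<alpha>) * (\<Sum>\<beta><N. v \<beta> * W \<beta> b))"
  have C: "?C \<in> carrier_mat m m"
    by (simp add: complement_mat_def)
  have R: "R \<in> carrier_mat m m"
    by (simp add: R_def)
  have "complement_mat m N n E U W = ?C + R"
    by (intro eq_matI)
      (simp_all add: complement_mat_def R_def sum_product sum.distrib[symmetric] algebra_simps)
  moreover have "vec_space.rank m ?C \<le> N - Suc n"
    using Suc.hyps(2) by (intro Suc.hyps(1) v) simp
  moreover have "vec_space.rank m R \<le> 1"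
    by (rule vec_space.rank_le_1_product_entries[OF R]) (simp add: R_def)
  ultimately show ?case
    using vec_space.rank_subadditive[OF C R] \<open>n < N\<close> by simp
qed

text \<open>Here \<open>A = E X E\<^sup>T\<close> and \<open>B = E Y E\<^sup>T\<close> with
  \<open>X\<close> and \<open>Y\<close> diagonal. After writing \<open>E\<^sup>T E = 1 - Q\<close>
  in both products, the terms without \<open>Q\<close> cancel because \<open>X Y = Y X\<close>, and
  each of the other two has rank at most \<open>N - n\<close>.\<close>

lemma rank_commutator_compression_le:
  fixes E :: "nat \<Rightarrow> nat \<Rightarrow> real" and x y :: "nat \<Rightarrow> real"
  assumes E: "orthonormal_rows n N E"
  defines "A \<equiv> Matrix.mat n n (\<lambda>(a, b). \<Sum>\<alpha><N. E a \<alpha> * x \<alpha> * E b \<alpha>)"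
    and "B \<equiv> Matrix.mat n n (\<lambda>(a, b). \<Sum>\<alpha><N. E a \<alpha> * y \<alpha> * E b \<alpha>)"
  shows "vec_space.rank n (commutator A B) \<le> 2 * (N - n)"
proof -
  let ?C = "complement_mat n N n E (\<lambda>a \<alpha>. E a \<alpha> * y \<alpha>) (\<lambda>\<beta> b. x \<beta> * E b \<beta>)"
  \<comment> \<open>The minus sign is put into the left factor, so that the commutator is a sum and
    subadditivity of the rank applies.\<close>
  let ?D = "complement_mat n N n E (\<lambda>a \<alpha>. - (E a \<alpha> * x \<alpha>)) (\<lambda>\<beta> b. y \<beta> * E b \<beta>)"
  have C: "?C \<in> carrier_mat n n" and D: "?D \<in> carrier_mat n n"
    by (simp_all add: complement_mat_def)
  \<comment> \<open>Exchanging the sums isolates the entries of \<open>E\<^sup>T E\<close> in the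
    product of two compressions.\<close>
  have prod: "(\<Sum>c<n. (\<Sum>\<alpha><N. E a \<alpha> * s \<alpha> * E c \<alpha>) * (\<Sum>\<beta><N. E c \<beta> * t \<beta> * E b \<beta>)) =
      (\<Sum>\<alpha><N. \<Sum>\<beta><N. E a \<alpha> * s \<alpha> * (\<Sum>c<n. E c \<alpha> * E c \<beta>) * (t \<beta> * E b \<beta>))"
    for s t :: "nat \<Rightarrow> real" and a b
  proof -
    let ?t = "\<lambda>c \<alpha> \<beta>. (E a \<alpha> * s \<alpha> * E c \<alpha>) * (E c \<beta> * t \<beta> * E b \<beta>)"
    have "(\<Sum>c<n. (\<Sum>\<alpha><N. E a \<alpha> * s \<alpha> * E c \<alpha>) * (\<Sum>\<beta><N. E c \<beta> * t \<beta> * E b \<beta>)) =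
        (\<Sum>c<n. \<Sum>\<alpha><N. \<Sum>\<beta><N. ?t c \<alpha> \<beta>)"
      by (simp add: sum_product)
    also have "\<dots> = (\<Sum>\<alpha><N. \<Sum>c<n. \<Sum>\<beta><N. ?t c \<alpha> \<beta>)"
      by (rule sum.swap)
    also have "\<dots> = (\<Sum>\<alpha><N. \<Sum>\<beta><N. \<Sum>c<n. ?t c \<alpha> \<beta>)"
      by (intro sum.cong refl sum.swap)
    finally show ?thesis
      by (simp add: sum_distrib_left sum_distrib_right mult_ac)
  qed
  have diag: "(\<Sum>\<alpha><N. \<Sum>\<beta><N. E a \<alpha> * s \<alpha> * (if \<alpha> = \<beta> then 1 else 0) * (t \<beta> * E b \<beta>)) =
      (\<Sum>\<alpha><N. E a \<alpha> * s \<alpha> * (t \<alpha> * E b \<alpha>))" for s t :: "nat \<Rightarrow> real" and a b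
    by (intro sum.cong refl) (simp add: if_distrib[of "\<lambda>z. _ * z * _"] cong: if_cong)
  \<comment> \<open>Splits \<open>1 - E\<^sup>T E\<close> into its two terms; the scalar
    \<open>r\<close> will be 1 for \<open>?C\<close> and -1 for \<open>?D\<close>.\<close>
  have lin: "(\<Sum>\<alpha><N. \<Sum>\<beta><N. r * f \<alpha> * (\<delta> \<alpha> \<beta> - R \<alpha> \<beta>) * g \<beta>) =
      r * ((\<Sum>\<alpha><N. \<Sum>\<beta><N. f \<alpha> * \<delta> \<alpha> \<beta> * g \<beta>) - (\<Sum>\<alpha><N. \<Sum>\<beta><N. f \<alpha> * R \<alpha> \<beta> * g \<beta>))"
    for r :: real and f g \<delta> R
  proof -
    have "r * f \<alpha> * (\<delta> \<alpha> \<beta> - R \<alpha> \<beta>) * g \<beta> = r * (f \<alpha> * \<delta> \<alpha> \<beta> * g \<beta>) - r * (f \<alpha> * R \<alpha> \<beta> * g \<beta>)"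
      for \<alpha> \<beta>
      by (simp add: algebra_simps)
    then show ?thesis
      by (simp add: sum_subtractf right_diff_distrib flip: sum_distrib_left)
  qed
  have swap: "(\<Sum>\<alpha><N. E a \<alpha> * y \<alpha> * (x \<alpha> * E b \<alpha>)) = (\<Sum>\<alpha><N. E a \<alpha> * x \<alpha> * (y \<alpha> * E b \<alpha>))"
    for a b
    by (intro sum.cong refl) (simp only: mult_ac)
  have eq: "commutator A B = ?C + ?D"
  proof (rule eq_matI)
    fix a b
    assume "a < dim_row (?C + ?D)" "b < dim_col (?C + ?D)"
    then have ab: "a < n" "b < n"
      by (simp_all add: complement_mat_def)
    have entry: "complement_mat n N n E (\<lambda>a \<alpha>. r * (E a \<alpha> * s \<alpha>)) (\<lambda>\<beta> b. t \<beta> * E b \<beta>) $$ (a, b) =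
        r * ((\<Sum>\<alpha><N. E a \<alpha> * s \<alpha> * (t \<alpha> * E b \<alpha>)) -
        (\<Sum>c<n. (\<Sum>\<alpha><N. E a \<alpha> * s \<alpha> * E c \<alpha>) * (\<Sum>\<beta><N. E c \<beta> * t \<beta> * E b \<beta>)))"
      for r :: real and s t
      using ab unfolding prod diag[symmetric] complement_mat_def
      by (simp only: index_mat prod.case lin[where f = "\<lambda>\<alpha>. E a \<alpha> * s \<alpha>"])
    have "commutator A B $$ (a, b) =
        (\<Sum>c<n. (\<Sum>\<alpha><N. E a \<alpha> * x \<alpha> * E c \<alpha>) * (\<Sum>\<beta><N. E c \<beta> * y \<beta> * E b \<beta>)) -
        (\<Sum>c<n. (\<Sum>\<alpha><N. E a \<alpha> * y \<alpha> * E c \<alpha>) * (\<Sum>\<beta><N. E c \<beta> * x \<beta> * E b \<beta>))"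
      using ab by (simp add: commutator_def A_def B_def scalar_prod_def lessThan_atLeast0)
    also have "\<dots> = ?C $$ (a, b) + ?D $$ (a, b)"
      using entry[of 1 y x] entry[of "-1" x y] swap[of a b] by simp
    finally show "commutator A B $$ (a, b) = (?C + ?D) $$ (a, b)"
      using ab C D by simp
  qed (simp_all add: commutator_def A_def B_def complement_mat_def)
  show ?thesis
    using vec_space.rank_subadditive[OF C D]
      rank_complement_mat_le[OF E, of n "\<lambda>a \<alpha>. E a \<alpha> * y \<alpha>" "\<lambda>\<beta> b. x \<beta> * E b \<beta>"]
      rank_complement_mat_le[OF E, of n "\<lambda>a \<alpha>. - (E a \<alpha> * x \<alpha>)" "\<lambda>\<beta> b. y \<beta> * E b \<beta>"]
    unfolding eq by linarith
qed

section \<open>Polynomial functions\<close>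

lemma zero_in_polys: "(\<lambda>x. 0) \<in> polys m"
  unfolding polys_def by (intro CollectI exI[of _ "\<lambda>k. 0"]) simp

lemma add_in_polys:
  assumes "f \<in> polys m" "g \<in> polys m"
  shows "(\<lambda>x. f x + g x) \<in> polys m"
proof -
  from assms obtain c d where
    "f = (\<lambda>x. \<Sum>k | (\<Sum>i\<in>UNIV. k i) \<le> m. c k * monomial_fun k x)"
    "g = (\<lambda>x. \<Sum>k | (\<Sum>i\<in>UNIV. k i) \<le> m. d k * monomial_fun k x)"
    unfolding polys_def by blast
  then have "(\<lambda>x. f x + g x) =
      (\<lambda>x. \<Sum>k | (\<Sum>i\<in>UNIV. k i) \<le> m. (c k + d k) * monomial_fun k x)"
    by (simp add: distrib_right sum.distrib)
  then show ?thesis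
    unfolding polys_def by (intro CollectI exI[of _ "\<lambda>k. c k + d k"])
qed

lemma cmult_in_polys:
  assumes "f \<in> polys m"
  shows "(\<lambda>x. r * f x) \<in> polys m"
proof -
  from assms obtain c where
    "f = (\<lambda>x. \<Sum>k | (\<Sum>i\<in>UNIV. k i) \<le> m. c k * monomial_fun k x)"
    unfolding polys_def by blast
  then have "(\<lambda>x. r * f x) = (\<lambda>x. \<Sum>k | (\<Sum>i\<in>UNIV. k i) \<le> m. (r * c k) * monomial_fun k x)"
    by (simp add: sum_distrib_left mult.assoc)
  then show ?thesis
    unfolding polys_def by (intro CollectI exI[of _ "\<lambda>k. r * c k"])
qed

lemma diff_in_polys:
  assumes "f \<in> polys m" "g \<in> polys m"
  shows "(\<lambda>x. f x - g x) \<in> polys m"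
  using add_in_polys[OF assms(1) cmult_in_polys[OF assms(2), of "-1"]] by simp

lemma sum_in_polys:
  assumes "\<And>j. j \<in> S \<Longrightarrow> f j \<in> polys m"
  shows "(\<lambda>x. \<Sum>j\<in>S. f j x) \<in> polys m"
  using assms
  by (induction S rule: infinite_finite_induct) (auto intro: zero_in_polys add_in_polys)

lemma monomial_in_polys:
  fixes k :: "'d::finite \<Rightarrow> nat"
  assumes "(\<Sum>i\<in>UNIV. k i) \<le> m"
  shows "monomial_fun k \<in> polys m"
proof -
  have "monomial_fun k =
      (\<lambda>x. \<Sum>l | (\<Sum>i\<in>UNIV. l i) \<le> m. (if l = k then 1 else 0) * monomial_fun l x)"
    using assms finite_multi_indices[where 'd = 'd and m = m]
    by (simp add: if_distrib[of "\<lambda>z. z * _"] cong: if_cong)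
  then show ?thesis
    unfolding polys_def by (intro CollectI exI[of _ "\<lambda>l. if l = k then 1 else 0"])
qed

lemma monomial_fun_add:
  "monomial_fun (\<lambda>i. k i + l i) x = monomial_fun k x * monomial_fun l x"
  by (simp add: monomial_fun_def power_add prod.distrib)

lemma mult_in_polys:
  assumes "f \<in> polys m" "g \<in> polys l"
  shows "(\<lambda>x. f x * g x) \<in> polys (m + l)"
proof -
  from assms obtain c d where
    "f = (\<lambda>x. \<Sum>k | (\<Sum>i\<in>UNIV. k i) \<le> m. c k * monomial_fun k x)"
    "g = (\<lambda>x. \<Sum>k | (\<Sum>i\<in>UNIV. k i) \<le> l. d k * monomial_fun k x)"
    unfolding polys_def by blast
  then have eq: "(\<lambda>x. f x * g x) = (\<lambda>x. \<Sum>k | (\<Sum>i\<in>UNIV. k i) \<le> m. \<Sum>h | (\<Sum>i\<in>UNIV. h i) \<le> l.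
      (c k * d h) * monomial_fun (\<lambda>i. k i + h i) x)"
    by (simp add: sum_product monomial_fun_add mult_ac)
  show ?thesis
    unfolding eq
    by (intro sum_in_polys cmult_in_polys monomial_in_polys) (simp add: sum.distrib add_mono)
qed

lemma coordinate_in_polys: "(\<lambda>x. x $ i) \<in> polys 1"
proof -
  have "(\<lambda>x. x $ i) = monomial_fun (\<lambda>j. if j = i then 1 else 0)"
    by (simp add: fun_eq_iff monomial_fun_def if_distrib[of "\<lambda>z. _ ^ z"] cong: if_cong)
  then show ?thesis
    by (simp add: monomial_in_polys)
qed

lemma polys_mono:
  assumes "m \<le> l" "f \<in> polys m"
  shows "f \<in> polys l"
proof -
  from assms(2) obtain c where
    f: "f = (\<lambda>x. \<Sum>k | (\<Sum>i\<in>UNIV. k i) \<le> m. c k * monomial_fun k x)"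
    unfolding polys_def by blast
  show ?thesis
    unfolding f using assms(1) by (intro sum_in_polys cmult_in_polys monomial_in_polys) simp
qed

section \<open>Independence and number of the monomials\<close>

lemma separating_weights:
  assumes "finite S"
  shows "\<exists>a :: 'i \<Rightarrow> nat. \<forall>k l. (\<forall>i\<in>S. k i \<le> m \<and> l i \<le> m) \<longrightarrow>
    (\<Sum>i\<in>S. k i * a i) = (\<Sum>i\<in>S. l i * a i) \<longrightarrow> (\<forall>i\<in>S. k i = l i)"
  using assms
proof (induction S)
  case empty
  then show ?case
    by simp
next
  case (insert s S)
  from insert.IH obtain a where a: "\<forall>k l. (\<forall>i\<in>S. k i \<le> m \<and> l i \<le> m) \<longrightarrow>
    (\<Sum>i\<in>S. k i * a i) = (\<Sum>i\<in>S. l i * a i) \<longrightarrow> (\<forall>i\<in>S. k i = l i)" ..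
  \<comment> \<open>The weights act as place values: with exponents at most \<open>m\<close>, the
    variables in \<open>S\<close> contribute less than \<open>b\<close>, so division by
    \<open>b\<close> recovers the exponent of \<open>s\<close>.\<close>
  define b where "b = Suc (m * (\<Sum>i\<in>S. a i))"
  have upd: "(\<Sum>i\<in>S. k i * (a(s := b)) i) = (\<Sum>i\<in>S. k i * a i)" for k
    using insert.hyps by (intro sum.cong) auto
  have small: "(\<Sum>i\<in>S. k i * a i) < b" if "\<forall>i\<in>S. k i \<le> m" for k
    using that unfolding b_def sum_distrib_left less_Suc_eq_le by (intro sum_mono mult_right_mono) auto
  show ?case
  proof (intro exI[of _ "a(s := b)"] allI impI)
    fix k l :: "'i \<Rightarrow> nat"
    assume kl: "\<forall>i\<in>insert s S. k i \<le> m \<and> l i \<le> m"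
      and eq: "(\<Sum>i\<in>insert s S. k i * (a(s := b)) i) = (\<Sum>i\<in>insert s S. l i * (a(s := b)) i)"
    let ?r = "\<Sum>i\<in>S. k i * a i" and ?t = "\<Sum>i\<in>S. l i * a i"
    have lt: "?r < b" "?t < b"
      using kl by (auto intro: small)
    have eq': "k s * b + ?r = l s * b + ?t"
      using eq insert.hyps upd by simp
    have "k s = (k s * b + ?r) div b"
      using lt by simp
    also have "\<dots> = l s"
      using lt by (simp add: eq')
    finally have "k s = l s" .
    with eq' have "?r = ?t"
      by simp
    then have "\<forall>i\<in>S. k i = l i"
      using a[THEN spec[of _ k], THEN spec[of _ l]] kl by blast
    with \<open>k s = l s\<close> show "\<forall>i\<in>insert s S. k i = l i"
      by blast
  qed
qed

text \<open>Kronecker substitution \<open>x\<^sub>i = t ^ a\<^sub>i\<close> sends distinct monomials to distinct powers of \<open>t\<close>.\<close>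

lemma monomials_independent:
  fixes c :: "('d::finite \<Rightarrow> nat) \<Rightarrow> real"
  assumes zero: "\<And>x. (\<Sum>k | (\<Sum>i\<in>UNIV. k i) \<le> m. c k * monomial_fun k x) = 0"
    and k: "(\<Sum>i\<in>UNIV. k i) \<le> m"
  shows "c k = 0"
proof -
  let ?K = "{k :: 'd \<Rightarrow> nat. (\<Sum>i\<in>UNIV. k i) \<le> m}"
  obtain a :: "'d \<Rightarrow> nat" where a: "\<And>k l. (\<forall>i. k i \<le> m \<and> l i \<le> m) \<Longrightarrow>
    (\<Sum>i\<in>UNIV. k i * a i) = (\<Sum>i\<in>UNIV. l i * a i) \<Longrightarrow> (\<forall>i. k i = l i)"
    using separating_weights[of "UNIV :: 'd set" m] by auto
  define \<phi> where "\<phi> k = (\<Sum>i\<in>UNIV. k i * a i)" for k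
  have bound: "l i \<le> m" if "l \<in> ?K" for l i
    using that member_le_sum[of i UNIV l] by simp
  have \<phi>_eq: "\<phi> l = \<phi> k \<longleftrightarrow> l = k" if "l \<in> ?K" for l
  proof
    assume "\<phi> l = \<phi> k"
    then have "\<forall>i. l i = k i"
      using bound[OF that] bound[of k] k unfolding \<phi>_def by (intro a) simp_all
    then show "l = k"
      by (simp add: fun_eq_iff)
  qed simp
  define p where "p = (\<Sum>l\<in>?K. monom (c l) (\<phi> l))"
  have "poly p t = 0" for t
  proof -
    \<comment> \<open>Here \<open>\<chi>\<close> builds a vector from its components. Along this
      curve the monomial of \<open>l\<close> becomes the single power
      \<open>t ^ \<phi> l\<close>.\<close>
    have "monomial_fun l (\<chi> i. t ^ a i) = t ^ \<phi> l" for l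
      by (simp add: monomial_fun_def \<phi>_def power_sum power_mult[symmetric] mult.commute)
    then show ?thesis
      using zero[of "\<chi> i. t ^ a i"] by (simp add: p_def poly_sum poly_monom)
  qed
  then have "p = 0"
    using poly_all_0_iff_0 by blast
  \<comment> \<open>No other multi-index in \<open>?K\<close> is sent to the exponent
    \<open>\<phi> k\<close>, so \<open>c k\<close> alone contributes to this coefficient.\<close>
  have "coeff p (\<phi> k) = (\<Sum>l\<in>?K. if l = k then c l else 0)"
    unfolding p_def coeff_sum by (intro sum.cong) (auto simp: \<phi>_eq)
  also have "\<dots> = c k"
    using k finite_multi_indices[where 'd = 'd and m = m] by simp
  finally show ?thesis
    using \<open>p = 0\<close> by simp
qed

text \<open>Prepending the slack \<open>m - |k|\<close> to the exponents turns the inequality into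
  an equation for one more natural number, whose solutions are counted by stars and bars.\<close>

lemma card_multi_indices:
  "card {k :: 'd::finite \<Rightarrow> nat. (\<Sum>i\<in>UNIV. k i) \<le> m} = (CARD('d) + m) choose CARD('d)"
proof -
  obtain ds :: "'d list" where ds: "set ds = UNIV" "distinct ds"
    using finite_distinct_list[OF finite_class.finite_UNIV] by blast
  then have len: "length ds = CARD('d)"
    by (metis distinct_card)
  have sum_ds: "sum_list (map k ds) = (\<Sum>i\<in>UNIV. k i)" for k :: "'d \<Rightarrow> nat"
    using ds by (simp add: sum_list_distinct_conv_sum_set)
  let ?K = "{k :: 'd \<Rightarrow> nat. (\<Sum>i\<in>UNIV. k i) \<le> m}"
  let ?L = "{l :: nat list. length l = Suc CARD('d) \<and> sum_list l = m}"
  let ?f = "\<lambda>k :: 'd \<Rightarrow> nat. (m - (\<Sum>i\<in>UNIV. k i)) # map k ds"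
  have "bij_betw ?f ?K ?L"
  proof (rule bij_betw_imageI)
    show "inj_on ?f ?K"
      using ds by (auto intro!: inj_onI simp: fun_eq_iff)
    show "?f ` ?K = ?L"
    proof
      show "?f ` ?K \<subseteq> ?L"
        by (auto simp: len sum_ds)
      show "?L \<subseteq> ?f ` ?K"
      proof
        fix l
        assume "l \<in> ?L"
        then obtain h t where l: "l = h # t" "length t = length ds" "h + sum_list t = m"
          by (auto simp: len length_Suc_conv)
        define k where "k i = the (map_of (zip ds t) i)" for i
        have "map k ds = t"
          using ds(2) l(2) unfolding k_def by (auto intro!: nth_equalityI simp: map_of_zip_nth)
        with l sum_ds[of k] show "l \<in> ?f ` ?K"
          by (intro image_eqI[of _ _ k]) auto
      qed
    qed
  qed
  then have "card ?K = card ?L"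
    by (rule bij_betw_same_card)
  then show ?thesis
    using card_length_sum_list[of "Suc CARD('d)" m] binomial_symmetric[of m "CARD('d) + m"]
    by (simp add: add.commute)
qed

text \<open>The binomial coefficient counts the monomials. Were \<open>n\<close> smaller, their
  coefficient vectors with respect to \<open>e\<close> would be dependent, which gives a nontrivial
  vanishing combination of monomials.\<close>

lemma spanning_set_ge_monomials:
  fixes e :: "nat \<Rightarrow> real ^ 'd::finite \<Rightarrow> real"
  assumes span: "\<forall>p\<in>polys m. \<exists>c. p = (\<lambda>x. \<Sum>a<n. c a * e a x)"
  shows "(CARD('d) + m) choose CARD('d) \<le> n"
proof (rule ccontr)
  let ?K = "{k :: 'd \<Rightarrow> nat. (\<Sum>i\<in>UNIV. k i) \<le> m}"
  assume "\<not> ?thesis"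
  then have n: "n < card ?K"
    by (simp add: card_multi_indices)
  obtain h where h: "bij_betw h {..<card ?K} ?K"
    using ex_bij_betw_nat_finite[OF finite_multi_indices] by (metis lessThan_atLeast0)
  have "\<forall>k\<in>?K. \<exists>c. monomial_fun k = (\<lambda>x. \<Sum>a<n. c a * e a x)"
    using span monomial_in_polys by blast
  from bchoice[OF this] obtain C
    where C: "\<And>k. k \<in> ?K \<Longrightarrow> monomial_fun k = (\<lambda>x. \<Sum>a<n. C k a * e a x)"
    by blast
  obtain v where v: "\<exists>j<card ?K. v j \<noteq> 0" "\<And>a. a < n \<Longrightarrow> (\<Sum>j<card ?K. C (h j) a * v j) = 0"
    by (rule underdetermined_system[OF n, of "\<lambda>a j. C (h j) a"]) (rule that)
  \<comment> \<open>The inverse of the enumeration \<open>h\<close> carries the solution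
    \<open>v\<close> back to coefficients indexed by multi-indices.\<close>
  define g where "g = the_inv_into {..<card ?K} h"
  have gh: "g (h j) = j" if "j < card ?K" for j
    using h that unfolding g_def bij_betw_def by (simp add: the_inv_into_f_f)
  have hK: "h j \<in> ?K" if "j < card ?K" for j
    using h that by (auto simp: bij_betw_def)
  have "(\<Sum>k\<in>?K. v (g k) * monomial_fun k x) = 0" for x
  proof -
    have "(\<Sum>k\<in>?K. v (g k) * monomial_fun k x) = (\<Sum>j<card ?K. v (g (h j)) * monomial_fun (h j) x)"
      by (rule sum.reindex_bij_betw[OF h, symmetric])
    also have "\<dots> = (\<Sum>j<card ?K. v j * (\<Sum>a<n. C (h j) a * e a x))"
      using gh C hK by (intro sum.cong) auto
    also have "\<dots> = (\<Sum>a<n. (\<Sum>j<card ?K. C (h j) a * v j) * e a x)"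
      unfolding sum_distrib_left sum_distrib_right by (subst sum.swap) (simp add: mult_ac)
    also have "\<dots> = 0"
      using v(2) by simp
    finally show ?thesis .
  qed
  then have vg: "v (g k) = 0" if "k \<in> ?K" for k
    using monomials_independent[where c = "\<lambda>k. v (g k)" and m = m and k = k] that by simp
  have "v j = 0" if "j < card ?K" for j
    using vg[OF hK[OF that]] gh[OF that] by simp
  then show False
    using v(1) by blast
qed

section \<open>Operators and cubature\<close>

text \<open>Turns inner products into finite sums, from which symmetry and linearity can be read off
  directly.\<close>

lemma weighted_inner_cubature:
  assumes "positive_cubature_rule \<Omega> w D N xs ws" "a \<in> polys l" "b \<in> polys m" "l + m \<le> D"
  shows "weighted_inner \<Omega> w a b = (\<Sum>\<alpha>=1..N. ws \<alpha> * (a (xs \<alpha>) * b (xs \<alpha>)))"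
proof -
  have exact: "\<forall>f\<in>polys D. (LINT x:\<Omega>|lebesgue. w x * f x) = (\<Sum>\<alpha>=1..N. ws \<alpha> * f (xs \<alpha>))"
    using assms(1) unfolding positive_cubature_rule_def by (elim conjE)
  have "(\<lambda>x. a x * b x) \<in> polys D"
    using assms(4) mult_in_polys[OF assms(2,3)] by (rule polys_mono)
  from bspec[OF exact this] show ?thesis
    by (simp add: weighted_inner_def mult.assoc)
qed

lemma weighted_inner_self_eq_0:
  assumes "suitable_weight \<Omega> w" "p \<in> polys m" "weighted_inner \<Omega> w p p = 0"
  shows "p = (\<lambda>x. 0)"
proof (rule ccontr)
  assume "p \<noteq> (\<lambda>x. 0)"
  then have "0 < (LINT x:\<Omega>|lebesgue. w x * (p x)\<^sup>2)"
    using assms(1,2) by (simp add: suitable_weight_def)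
  with assms(3) show False
    by (simp add: weighted_inner_def power2_eq_square mult.assoc)
qed

text \<open>Since \<open>e a\<close> lies in \<open>polys q\<close>, projecting
  \<open>x\<^sub>i p\<close> does not change its inner product with \<open>e a\<close>. The degrees
  add up to \<open>q + (q + 1) = 2 * q + 1\<close>, just within the exactness of the rule.\<close>

lemma inner_chi:
  fixes xs :: "nat \<Rightarrow> real ^ 'd::finite"
  assumes w: "suitable_weight \<Omega> w"
    and cub: "positive_cubature_rule \<Omega> w (2 * q + 1) N xs ws"
    and onb: "orthonormal_basis \<Omega> w q n e"
    and "a < n" and p: "p \<in> polys q"
  shows "weighted_inner \<Omega> w (e a) (chi \<Omega> w q i p) =
    (\<Sum>\<alpha>=1..N. ws \<alpha> * (e a (xs \<alpha>) * (xs \<alpha> $ i * p (xs \<alpha>))))"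
proof -
  define I where "I f g = (\<Sum>\<alpha>=1..N. ws \<alpha> * (f (xs \<alpha>) * g (xs \<alpha>)))" for f g :: "real ^ 'd \<Rightarrow> real"
  have I: "weighted_inner \<Omega> w f g = I f g"
    if "f \<in> polys l" "g \<in> polys m" "l + m \<le> 2 * q + 1" for f g l m
    unfolding I_def using cub that by (rule weighted_inner_cubature)
  have I_diff: "I (\<lambda>x. f x - g x) h = I f h - I g h" for f g h
    by (simp add: I_def left_diff_distrib right_diff_distrib sum_subtractf)
  have I_commute: "I f g = I g f" for f g
    by (simp add: I_def mult.commute)
  have I_sum: "I (\<lambda>x. \<Sum>b<n. c b * f b x) h = (\<Sum>b<n. c b * I (f b) h)" for c f h
    unfolding I_def sum_distrib_left sum_distrib_right by (subst sum.swap) (simp add: mult_ac)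
  have e: "e b \<in> polys q" if "b < n" for b
    using onb that by (simp add: orthonormal_basis_def)
  have orth: "I (e b) (e c) = (if b = c then 1 else 0)" if "b < n" "c < n" for b c
    using onb that I[OF e e] by (simp add: orthonormal_basis_def)
  define xp where "xp = (\<lambda>x. x $ i * p x)"
  have xp: "xp \<in> polys (q + 1)"
    using mult_in_polys[OF coordinate_in_polys p] by (simp add: xp_def)
  \<comment> \<open>The definite description in \<open>orth_proj\<close> is resolved by exhibiting
    the projection: it is the Fourier expansion of \<open>xp\<close> in the orthonormal
    basis.\<close>
  define r where "r = (\<lambda>x. \<Sum>b<n. I xp (e b) * e b x)"
  have r: "r \<in> polys q"
    unfolding r_def by (intro sum_in_polys cmult_in_polys e) simp
  have r_e: "I r (e b) = I xp (e b)" if "b < n" for b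
    using that by (simp add: r_def I_sum orth if_distrib[of "\<lambda>z. _ * z"] cong: if_cong)
  have r_orth: "I (\<lambda>x. xp x - r x) s = 0" if "s \<in> polys q" for s
  proof -
    have "\<exists>c. s = (\<lambda>x. \<Sum>b<n. c b * e b x)"
      using onb that by (simp add: orthonormal_basis_def)
    then obtain c where s: "s = (\<lambda>x. \<Sum>b<n. c b * e b x)" ..
    have "I s (\<lambda>x. xp x - r x) = (\<Sum>b<n. c b * I (e b) (\<lambda>x. xp x - r x))"
      unfolding s by (rule I_sum)
    also have "\<dots> = 0"
      by (intro sum.neutral) (simp add: I_commute[of "e _"] I_diff r_e)
    finally show ?thesis
      using I_commute[of s] by simp
  qed
  have inner_eq: "weighted_inner \<Omega> w (\<lambda>x. xp x - t x) s = I (\<lambda>x. xp x - t x) s"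
    if "t \<in> polys q" "s \<in> polys q" for t s
    using that by (intro I[of _ "q + 1" _ q] diff_in_polys xp polys_mono[of q "q + 1"]) auto
  have "chi \<Omega> w q i p = r"
    unfolding chi_def orth_proj_def xp_def[symmetric]
  proof (rule the_equality)
    show "r \<in> polys q \<and> (\<forall>s\<in>polys q. weighted_inner \<Omega> w (\<lambda>x. xp x - r x) s = 0)"
      using r r_orth inner_eq by simp
  next
    fix t
    assume t: "t \<in> polys q \<and> (\<forall>s\<in>polys q. weighted_inner \<Omega> w (\<lambda>x. xp x - t x) s = 0)"
    \<comment> \<open>The difference of two projections lies in \<open>polys q\<close> and is
      orthogonal to that space, hence to itself; positive definiteness makes it zero.\<close>
    define u where "u = (\<lambda>x. t x - r x)"
    have u: "u \<in> polys q"
      using t r by (simp add: u_def diff_in_polys)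
    have "I (\<lambda>x. xp x - t x) u = 0"
      using t u inner_eq[of t u] by simp
    then have "I u u = 0"
      using r_orth[OF u] unfolding u_def by (simp add: I_diff)
    then have "weighted_inner \<Omega> w u u = 0"
      using I[OF u u] by simp
    then have "u = (\<lambda>x. 0)"
      by (rule weighted_inner_self_eq_0[OF w u])
    then show "t = r"
      by (simp add: u_def fun_eq_iff)
  qed
  then have "weighted_inner \<Omega> w (e a) (chi \<Omega> w q i p) = I r (e a)"
    using I[OF e[OF \<open>a < n\<close>] r] I_commute[of r] by simp
  then show ?thesis
    unfolding r_e[OF \<open>a < n\<close>] I_commute[of xp] by (simp only: I_def xp_def)
qed

theorem theorem12:
  fixes \<Omega> :: "(real ^ 'd::finite) set" and w :: "real ^ 'd \<Rightarrow> real"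
    and q N n :: nat
    and xs :: "nat \<Rightarrow> real ^ 'd" and ws :: "nat \<Rightarrow> real"
    and e :: "nat \<Rightarrow> real ^ 'd \<Rightarrow> real"
    and A :: "'d \<Rightarrow> real Matrix.mat"
  assumes "suitable_weight \<Omega> w"
    and "positive_cubature_rule \<Omega> w (2 * q + 1) N xs ws"
    and "orthonormal_basis \<Omega> w q n e"
    and "\<And>i. A i = chi_mat \<Omega> w q n e i"
  shows "real N \<ge> real ((CARD('d) + q) choose CARD('d))
           + 1 / 2 * real (MAX (i, j)\<in>UNIV. vec_space.rank n (commutator (A i) (A j)))"
proof -
  note cub = assms(2) and onb = assms(3)
  have ws: "ws (Suc \<alpha>) > 0" if "\<alpha> < N" for \<alpha>
    using cub that by (simp add: positive_cubature_rule_def)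
  \<comment> \<open>The square root splits each positive weight evenly between two factors;
    \<open>Suc\<close> shifts the node numbers \<open>1..N\<close> to indices below
    \<open>N\<close>.\<close>
  define E where "E a \<alpha> = sqrt (ws (Suc \<alpha>)) * e a (xs (Suc \<alpha>))" for a \<alpha>
  have shift: "(\<Sum>\<alpha>=1..N. f \<alpha>) = (\<Sum>\<alpha><N. f (Suc \<alpha>))" for f :: "nat \<Rightarrow> real"
    by (simp add: sum.atLeast1_atMost_eq)
  \<comment> \<open>Taking \<open>s = 1\<close> gives the Gram matrix of the basis, and taking a
    coordinate of the node gives \<open>A i\<close>.\<close>
  have EE: "E a \<alpha> * s * E b \<alpha> = ws (Suc \<alpha>) * (e a (xs (Suc \<alpha>)) * (s * e b (xs (Suc \<alpha>))))"
    if "\<alpha> < N" for a b \<alpha> s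
  proof -
    have "E a \<alpha> * s * E b \<alpha> =
        (sqrt (ws (Suc \<alpha>)) * sqrt (ws (Suc \<alpha>))) * (e a (xs (Suc \<alpha>)) * (s * e b (xs (Suc \<alpha>))))"
      by (simp only: E_def mult_ac)
    then show ?thesis
      using ws[OF that] by simp
  qed
  have e: "e a \<in> polys q" if "a < n" for a
    using onb that by (simp add: orthonormal_basis_def)
  have rows: "orthonormal_rows n N E"
    unfolding orthonormal_rows_def
  proof (intro allI impI)
    fix a b
    assume "a < n" "b < n"
    then have "(if a = b then 1 else 0) = weighted_inner \<Omega> w (e a) (e b)"
      using onb by (simp add: orthonormal_basis_def)
    also have "\<dots> = (\<Sum>\<alpha>=1..N. ws \<alpha> * (e a (xs \<alpha>) * e b (xs \<alpha>)))"
      using \<open>a < n\<close> \<open>b < n\<close> by (intro weighted_inner_cubature[OF cub e e]) auto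
    also have "\<dots> = (\<Sum>\<alpha><N. E a \<alpha> * E b \<alpha>)"
      unfolding shift using EE[of _ a 1 b] by (intro sum.cong) auto
    finally show "(\<Sum>\<alpha><N. E a \<alpha> * E b \<alpha>) = (if a = b then 1 else 0)"
      by simp
  qed
  have A: "A i = Matrix.mat n n (\<lambda>(a, b). \<Sum>\<alpha><N. E a \<alpha> * (xs (Suc \<alpha>) $ i) * E b \<alpha>)" for i
    unfolding assms(4) chi_mat_def
    by (intro cong_mat) (auto simp: inner_chi[OF assms(1-3) _ e] shift EE simp del: One_nat_def)
  have "vec_space.rank n (commutator (A i) (A j)) \<le> 2 * (N - n)" for i j
    unfolding A by (rule rank_commutator_compression_le[OF rows])
  then have "(MAX (i, j)\<in>UNIV. vec_space.rank n (commutator (A i) (A j))) \<le> 2 * (N - n)"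
    by (intro Max.boundedI) auto
  moreover have "(CARD('d) + q) choose CARD('d) \<le> n"
    using onb by (intro spanning_set_ge_monomials[where e = e and m = q]) (simp add: orthonormal_basis_def)
  \<comment> \<open>By \<open>n \<le> N\<close> the truncated difference \<open>N - n\<close> is the
    true one, so half the maximal rank is at most \<open>N - n\<close> over the reals.\<close>
  ultimately show ?thesis
    using orthonormal_rows_le[OF rows] by linarith
qed

end
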